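(* Let $V:S^{m-1}\to S^{m-1}$ be a dissipative quadratic stochastic operator written in the form $$(Vx)_k=\sum_{i\in\alpha_k}x_i^2+2\sum_{i<j}p_{ij,k}x_ix_j,\qquad k=1,\dots,m,$$ where $\alpha_1,\dots,\alpha_m$ are pairwise disjoint (possibly empty) subsets of $I=\{1,\dots,m\}$ with $\bigcup_{k=1}^m\alpha_k=I$. Put $a_{ij}=(p_{ij,1},\dots,p_{ij,m})$. Then: (i) if $j\in\alpha_{k_0}$, then $p_{ij,k_0}=(a_{ij})_{[1]}\ge\frac12$ for all $i=1,\dots,m$; (ii) if $m\ge 3$, then $(a_{ij})_{[k]}=0$ for all $k\ge 3$ and all $i,j=1,\dots,m$.
   Context: $S^{m-1}=\{x\in\mathbb{R}^m: x_i\ge 0,\ \sum_{i=1}^m x_i=1\}$. A quadratic stochastic operator (q.s.o.) is a map $V:S^{m-1}\to S^{m-1}$ of the form $(Vx)_k=\sum_{i,j=1}^m p_{ij,k}x_ix_j$, $k=1,\dots,m$, where $p_{ij,k}=p_{ji,k}\ge 0$ and $\sum_{k=1}^m p_{ij,k}=1$ for all $i,j$. For $x\in\mathbb{R}^m$, let $x_{[1]}\ge\cdots\ge x_{[m]}$ denote the coordinates of $x$ in decreasing order. For $x,y\in\mathbb{R}^m$, write $x\prec y$ (equivalently $y\succ x$) if $\sum_{i=1}^k x_{[i]}\le\sum_{i=1}^k y_{[i]}$ for $k=1,\dots,m-1$ and $\sum_{i=1}^m x_{[i]}=\sum_{i=1}^m y_{[i]}$. $V$ is dissipative if $Vx\succ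 x$ for all $x\in S^{m-1}$. Every dissipative q.s.o. can be written in the form used in the claim: for each $i$ exactly one of $p_{ii,1},\dots,p_{ii,m}$ equals $1$ and the others equal $0$, and $\alpha_k=\{i: p_{ii,k}=1\}$. *)

theory Defs
  imports "HOL-Analysis.Analysis" "HOL-Library.Multiset"
begin

definition std_simplex :: "(real ^ 'n::finite) set" where
  "std_simplex = {x. (\<forall>i. 0 \<le> x $ i) \<and> (\<Sum>i\<in>UNIV. x $ i) = 1}"

text \<open>The coordinate \<open>x\<^bsub>[k]\<^esub>\<close> of the decreasing rearrangement, counted from 1;
  it is meaningful only for \<open>1 \<le> k \<le> CARD('n)\<close>.\<close>

definition decr :: "real ^ 'n::finite \<Rightarrow> nat \<Rightarrow> real" where
  "decr x k = rev (sorted_list_of_multiset (image_mset (\<lambda>i. x $ i) (mset_set UNIV))) ! (k - 1)"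

text \<open>\<open>majorized_by x y\<close> is \<open>x \<prec> y\<close>.\<close>

definition majorized_by :: "real ^ 'n::finite \<Rightarrow> real ^ 'n \<Rightarrow> bool" where
  "majorized_by x y \<longleftrightarrow>
     (\<forall>k\<in>{1..CARD('n) - 1}. (\<Sum>i=1..k. decr x i) \<le> (\<Sum>i=1..k. decr y i)) \<and>
     (\<Sum>i=1..CARD('n). decr x i) = (\<Sum>i=1..CARD('n). decr y i)"

text \<open>Here \<open>p i j k\<close> is \<open>p\<^bsub>ij,k\<^esub>\<close>. Only the values of \<open>V\<close> on the simplex matter.\<close>

definition qso_with ::
    "('n::finite \<Rightarrow> 'n \<Rightarrow> 'n \<Rightarrow> real) \<Rightarrow> (real ^ 'n \<Rightarrow> real ^ 'n) \<Rightarrow> bool" where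
  "qso_with p V \<longleftrightarrow>
     V \<in> std_simplex \<rightarrow> std_simplex \<and>
     (\<forall>i j k. p i j k = p j i k \<and> 0 \<le> p i j k) \<and>
     (\<forall>i j. (\<Sum>k\<in>UNIV. p i j k) = 1) \<and>
     (\<forall>x\<in>std_simplex. \<forall>k. V x $ k = (\<Sum>i\<in>UNIV. \<Sum>j\<in>UNIV. p i j k * x $ i * x $ j))"

definition dissipative :: "(real ^ 'n::finite \<Rightarrow> real ^ 'n) \<Rightarrow> bool" where
  "dissipative V \<longleftrightarrow> (\<forall>x\<in>std_simplex. majorized_by x (V x))"

end

theory Submission
  imports Defs
begin

text \<open>Test dissipativity on the edges of the simplex. At \<open>x = (1 - t) e\<^sub>j + t e\<^sub>i\<close> with \<open>t\<close> small, the
  largest coordinate of \<open>V x\<close> is the \<open>k\<^sub>0\<close>-th, so the first majorization inequality reads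
  \<open>1 - t \<le> (1 - t)\<^sup>2 + 2 t (1 - t) p\<^bsub>ij,k\<^sub>0\<^esub> + O(t\<^sup>2)\<close>, and \<open>t \<rightarrow> 0\<close> gives \<open>p\<^bsub>ij,k\<^sub>0\<^esub> \<ge> 1/2\<close>. At an inner
  point of an edge the two largest coordinates of \<open>x\<close> sum to 1, hence so do those of \<open>V x\<close>; thus \<open>V x\<close>,
  whose support contains that of \<open>a\<^bsub>ij\<^esub>\<close>, has at most two nonzero coordinates.\<close>

section \<open>Decreasing rearrangement and majorization\<close>

text \<open>Sorting the indices by their coordinates, instead of sorting the values, keeps ties
  apart and lets the values of \<open>decr\<close> be traced to distinct indices. List positions
  count from 0, \<open>decr\<close> from 1.\<close>

lemma decr_enumeration:
  fixes y :: "real ^ 'n::finite"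
  obtains ks where "distinct ks" "set ks = UNIV" "length ks = CARD('n)"
    "\<And>k. 1 \<le> k \<Longrightarrow> k \<le> CARD('n) \<Longrightarrow> decr y k = y $ (ks ! (k - 1))"
    "\<And>r s. r \<le> s \<Longrightarrow> s < CARD('n) \<Longrightarrow> y $ (ks ! s) \<le> y $ (ks ! r)"
proof -
  obtain xs :: "'n list" where xs: "set xs = UNIV" "distinct xs"
    using finite_distinct_list[OF finite_class.finite_UNIV] by blast
  define zs where "zs = sort_key (\<lambda>i. y $ i) xs"
  have zs: "set zs = UNIV" "distinct zs" "sorted (map (\<lambda>i. y $ i) zs)"
    using xs by (simp_all add: zs_def)
  have len: "length zs = CARD('n)"
    using zs distinct_card by metis
  have "mset zs = mset_set UNIV"
    using zs mset_set_set by metis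
  then have "sorted_list_of_multiset (image_mset (\<lambda>i. y $ i) (mset_set UNIV))
      = sorted_list_of_multiset (mset (map (\<lambda>i. y $ i) zs))"
    by simp
  also have "\<dots> = map (\<lambda>i. y $ i) zs"
    unfolding sorted_list_of_multiset_mset using zs(3) by (rule sorted_sort_id)
  finally have eq: "rev (sorted_list_of_multiset (image_mset (\<lambda>i. y $ i) (mset_set UNIV)))
      = map (\<lambda>i. y $ i) (rev zs)"
    by (simp add: rev_map)
  show thesis
  proof (rule that[of "rev zs"])
    show "distinct (rev zs)" "set (rev zs) = UNIV" "length (rev zs) = CARD('n)"
      using zs len by simp_all
    show "decr y k = y $ (rev zs ! (k - 1))" if "1 \<le> k" "k \<le> CARD('n)" for k
      unfolding decr_def eq using that len by (subst nth_map) simp_all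
    show "y $ (rev zs ! s) \<le> y $ (rev zs ! r)" if "r \<le> s" "s < CARD('n)" for r s
      using sorted_nth_mono[OF zs(3), of "length zs - Suc s" "length zs - Suc r"] that len
      by (simp add: rev_nth)
  qed
qed

lemma le_decr_1: "y $ u \<le> decr y 1" for y :: "real ^ 'n::finite"
proof -
  obtain ks :: "'n list" where ks: "set ks = UNIV" "length ks = CARD('n)"
    "\<And>k. 1 \<le> k \<Longrightarrow> k \<le> CARD('n) \<Longrightarrow> decr y k = y $ (ks ! (k - 1))"
    "\<And>r s. r \<le> s \<Longrightarrow> s < CARD('n) \<Longrightarrow> y $ (ks ! s) \<le> y $ (ks ! r)"
    using decr_enumeration by metis
  obtain r where "r < CARD('n)" "ks ! r = u"
    using ks(1,2) by (metis UNIV_I in_set_conv_nth)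
  then show ?thesis
    using ks(3)[of 1] ks(4)[of 0 r] by simp
qed

lemma decr_1_attained:
  fixes y :: "real ^ 'n::finite"
  obtains u where "decr y 1 = y $ u"
proof -
  obtain ks :: "'n list" where
    "\<And>k. 1 \<le> k \<Longrightarrow> k \<le> CARD('n) \<Longrightarrow> decr y k = y $ (ks ! (k - 1))"
    using decr_enumeration by metis
  from this[of 1] show thesis
    using that by simp
qed

text \<open>Distinct indices occupy distinct positions, so one of them sits at position 1 or later
  and its coordinate is at most \<open>decr y 2\<close>; the other coordinate is at most
  \<open>decr y 1\<close>.\<close>

lemma add_le_decr_1_2:
  fixes y :: "real ^ 'n::finite"
  assumes "u \<noteq> v"
  shows "y $ u + y $ v \<le> decr y 1 + decr y 2"
proof -
  obtain ks :: "'n list" where ks: "set ks = UNIV" "length ks = CARD('n)"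
    "\<And>k. 1 \<le> k \<Longrightarrow> k \<le> CARD('n) \<Longrightarrow> decr y k = y $ (ks ! (k - 1))"
    "\<And>r s. r \<le> s \<Longrightarrow> s < CARD('n) \<Longrightarrow> y $ (ks ! s) \<le> y $ (ks ! r)"
    using decr_enumeration by metis
  obtain r s where rs: "r < CARD('n)" "ks ! r = u" "s < CARD('n)" "ks ! s = v"
    using ks(1,2) by (metis UNIV_I in_set_conv_nth)
  have "r \<noteq> s" using rs assms by auto
  then have "r \<ge> 1 \<or> s \<ge> 1" "CARD('n) \<ge> 2" using rs by auto
  then show ?thesis
    using ks(3)[of 1] ks(3)[of 2] ks(4)[of 0 r] ks(4)[of 0 s] ks(4)[of 1 r] ks(4)[of 1 s] rs
    by auto
qed

lemma decr_1_2_attained: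
  fixes y :: "real ^ 'n::finite"
  assumes "CARD('n) \<ge> 2"
  obtains u v where "u \<noteq> v" "decr y 1 = y $ u" "decr y 2 = y $ v"
proof -
  obtain ks :: "'n list" where ks: "distinct ks" "length ks = CARD('n)"
    "\<And>k. 1 \<le> k \<Longrightarrow> k \<le> CARD('n) \<Longrightarrow> decr y k = y $ (ks ! (k - 1))"
    using decr_enumeration by metis
  show thesis
    using that[of "ks ! 0" "ks ! 1"] ks(3)[of 1] ks(3)[of 2] ks(1,2) assms
    by (simp add: nth_eq_iff_index_eq)
qed

text \<open>Pigeonhole: if the k-th value were positive, positions 0, 1 and k - 1 would hold three
  distinct indices of positive coordinates, all in \<open>{u, v}\<close>.\<close>

lemma decr_eq_0_if_support_le_2:
  fixes y :: "real ^ 'n::finite"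
  assumes nonneg: "\<And>l. 0 \<le> y $ l" and supp: "\<And>l. l \<noteq> u \<Longrightarrow> l \<noteq> v \<Longrightarrow> y $ l = 0"
    and k: "3 \<le> k" "k \<le> CARD('n)"
  shows "decr y k = 0"
proof (rule ccontr)
  assume nz: "decr y k \<noteq> 0"
  obtain ks :: "'n list" where ks: "distinct ks" "length ks = CARD('n)"
    "\<And>k. 1 \<le> k \<Longrightarrow> k \<le> CARD('n) \<Longrightarrow> decr y k = y $ (ks ! (k - 1))"
    "\<And>r s. r \<le> s \<Longrightarrow> s < CARD('n) \<Longrightarrow> y $ (ks ! s) \<le> y $ (ks ! r)"
    using decr_enumeration by metis
  have "0 < y $ (ks ! (k - 1))"
    using nz nonneg[of "ks ! (k - 1)"] ks(3)[of k] k by simp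
  then have pos: "0 < y $ (ks ! r)" if "r \<le> k - 1" for r
    using ks(4)[OF that] k by force
  have "ks ! r \<in> {u, v}" if "r \<le> k - 1" for r
    using pos[OF that] supp by fastforce
  then have "ks ! 0 \<in> {u, v}" "ks ! 1 \<in> {u, v}" "ks ! (k - 1) \<in> {u, v}"
    using k by auto
  moreover have "ks ! 0 \<noteq> ks ! 1" "ks ! 0 \<noteq> ks ! (k - 1)" "ks ! 1 \<noteq> ks ! (k - 1)"
    using ks(1,2) k by (auto simp: nth_eq_iff_index_eq)
  ultimately show False by auto
qed

lemma majorized_by_decr_1:
  fixes x y :: "real ^ 'n::finite"
  assumes "majorized_by x y" "CARD('n) \<ge> 2"
  shows "decr x 1 \<le> decr y 1"
proof -
  have "1 \<in> {1..CARD('n) - 1}" using assms(2) by simp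
  then have "(\<Sum>i=1..1. decr x i) \<le> (\<Sum>i=1..1. decr y i)"
    using assms(1) unfolding majorized_by_def by blast
  then show ?thesis by simp
qed

lemma majorized_by_decr_2:
  fixes x y :: "real ^ 'n::finite"
  assumes "majorized_by x y" "CARD('n) \<ge> 3"
  shows "decr x 1 + decr x 2 \<le> decr y 1 + decr y 2"
proof -
  have "2 \<in> {1..CARD('n) - 1}" using assms(2) by simp
  then have "(\<Sum>i=1..2. decr x i) \<le> (\<Sum>i=1..2. decr y i)"
    using assms(1) unfolding majorized_by_def by blast
  moreover have "{1..2::nat} = {1, 2}" by auto
  ultimately show ?thesis by simp
qed

section \<open>Edges of the simplex\<close>

text \<open>The edge runs from vertex j at t = 0 to vertex i at t = 1. The case i = j is allowed and
  gives the vertex itself.\<close>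

definition edge_point :: "'n \<Rightarrow> 'n \<Rightarrow> real \<Rightarrow> real ^ 'n::finite" where
  "edge_point j i t = (1 - t) *\<^sub>R axis j 1 + t *\<^sub>R axis i 1"

lemma edge_point_nth:
  "edge_point j i t $ l = (if l = j then 1 - t else 0) + (if l = i then t else 0)"
  by (simp add: edge_point_def axis_def)

lemma sum_mult_edge_point:
  "(\<Sum>l\<in>UNIV. f l * edge_point j i t $ l) = (1 - t) * f j + t * f i"
  by (simp add: edge_point_nth distrib_left sum.distrib if_distrib[of "(*) _"] cong: if_cong)

lemma edge_point_in_simplex:
  assumes "0 \<le> t" "t \<le> 1"
  shows "edge_point j i t \<in> std_simplex"
  using sum_mult_edge_point[of "\<lambda>_. 1" j i t] assms
  by (auto simp: std_simplex_def edge_point_nth)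

lemma qso_edge_point:
  assumes qso: "qso_with p V" and t: "0 \<le> t" "t \<le> 1"
  shows "V (edge_point j i t) $ k
    = (1 - t)\<^sup>2 * p j j k + 2 * t * (1 - t) * p i j k + t\<^sup>2 * p i i k"
proof -
  let ?x = "edge_point j i t"
  have "V ?x $ k = (\<Sum>r\<in>UNIV. \<Sum>s\<in>UNIV. p r s k * ?x $ r * ?x $ s)"
    using qso edge_point_in_simplex[OF t] unfolding qso_with_def by blast
  also have "\<dots> = (\<Sum>r\<in>UNIV. ((1 - t) * p r j k + t * p r i k) * ?x $ r)"
  proof (rule sum.cong)
    show "(\<Sum>s\<in>UNIV. p r s k * ?x $ r * ?x $ s) = ((1 - t) * p r j k + t * p r i k) * ?x $ r" for r
      unfolding sum_mult_edge_point[of "\<lambda>s. p r s k * ?x $ r"] by (simp add: algebra_simps)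
  qed simp
  also have "\<dots> = (1 - t) * ((1 - t) * p j j k + t * p j i k) + t * ((1 - t) * p i j k + t * p i i k)"
    by (rule sum_mult_edge_point)
  also have "p j i k = p i j k"
    using qso unfolding qso_with_def by blast
  finally show ?thesis
    by (simp add: power2_eq_square algebra_simps)
qed

lemma qso_in_simplex: "qso_with p V \<Longrightarrow> x \<in> std_simplex \<Longrightarrow> V x \<in> std_simplex"
  unfolding qso_with_def by blast

lemma std_simplex_add_le_1:
  assumes "x \<in> std_simplex" "k \<noteq> l"
  shows "x $ k + x $ l \<le> 1"
proof -
  have "sum (($) x) {k, l} \<le> sum (($) x) UNIV"
    using assms(1) by (intro sum_mono2) (auto simp: std_simplex_def)
  then show ?thesis
    using assms by (simp add: std_simplex_def)
qed

lemma std_simplex_nth_eq_0: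
  assumes x: "x \<in> std_simplex" and "k \<noteq> l" "1 \<le> x $ k + x $ l" "r \<noteq> k" "r \<noteq> l"
  shows "x $ r = 0"
proof -
  have "sum (($) x) {k, l, r} \<le> sum (($) x) UNIV"
    using x by (intro sum_mono2) (auto simp: std_simplex_def)
  moreover have "0 \<le> x $ r" using x by (simp add: std_simplex_def)
  moreover have "sum (($) x) UNIV = 1" using x by (simp add: std_simplex_def)
  ultimately show ?thesis
    using assms by simp
qed

section \<open>Consequences of dissipativity on the edges\<close>

text \<open>Instead of a limit t \<rightarrow> 0, one explicit t, computed from the assumed gap
  below 1/2, already violates the first majorization inequality.\<close>

lemma dissipative_qso_half_le:
  fixes V :: "real ^ 'n::finite \<Rightarrow> real ^ 'n"
  assumes qso: "qso_with p V" and diss: "dissipative V" and vertex: "p j j k0 = 1"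
  shows "1 / 2 \<le> p i j k0"
proof (rule ccontr)
  assume neg: "\<not> 1 / 2 \<le> p i j k0"
  then have "i \<noteq> j" using vertex by auto
  then have card: "CARD('n) \<ge> 2"
    using card_mono[of UNIV "{i, j}"] by simp
  have p0: "0 \<le> p r s k" and p1: "(\<Sum>k\<in>UNIV. p r s k) = 1" for r s k
    using qso unfolding qso_with_def by auto
  have ple: "p r s k \<le> 1" for r s k
    using member_le_sum[of k UNIV "p r s"] p0 p1 by simp
  \<comment> \<open>This makes \<open>0 < t \<le> 1/4\<close> and puts \<open>t\<close> strictly below \<open>(1 - t) * (1 - 2 * p i j k0)\<close>.\<close>
  define t where "t = (1 - 2 * p i j k0) / 4"
  have t: "0 < t" "t \<le> 1 / 4" and pt: "p i j k0 = 1 / 2 - 2 * t"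
    using neg p0[of i j k0] by (auto simp: t_def field_simps)
  have t01: "0 \<le> t" "t \<le> 1" using t by auto
  define x where "x = edge_point j i t"
  have x: "x \<in> std_simplex" using edge_point_in_simplex[OF t01] by (simp add: x_def)
  have Vx: "V x \<in> std_simplex" using qso_in_simplex[OF qso x] .
  have Vk0: "V x $ k0 = (1 - t)\<^sup>2 + 2 * t * (1 - t) * p i j k0 + t\<^sup>2 * p i i k0"
    using qso_edge_point[OF qso t01, of j i k0] by (simp add: x_def vertex)
  have "1 - t = x $ j" using \<open>i \<noteq> j\<close> by (simp add: x_def edge_point_nth)
  also have "\<dots> \<le> decr x 1" by (rule le_decr_1)
  also have "\<dots> \<le> decr (V x) 1"
    using majorized_by_decr_1[OF _ card] diss x unfolding dissipative_def by blast
  finally obtain k where k: "1 - t \<le> V x $ k" using decr_1_attained by metis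
  have lower: "(1 - t)\<^sup>2 \<le> V x $ k0"
    unfolding Vk0 using p0[of i j k0] p0[of i i k0] t by simp
  \<comment> \<open>Otherwise two coordinates of a simplex point would sum to at least 3/4 + 9/16 >
    1.\<close>
  have "k = k0"
  proof (rule ccontr)
    assume "k \<noteq> k0"
    then have "1 - t + (1 - t)\<^sup>2 \<le> 1"
      using std_simplex_add_le_1[OF Vx, of k k0] k lower by linarith
    moreover have "(3 / 4)\<^sup>2 \<le> (1 - t)\<^sup>2" using t by (intro power_mono) auto
    ultimately show False using t by (simp add: power2_eq_square)
  qed
  then have "1 - t \<le> (1 - t)\<^sup>2 + 2 * t * (1 - t) * p i j k0 + t\<^sup>2 * p i i k0"
    using k Vk0 by simp
  also have "\<dots> \<le> (1 - t)\<^sup>2 + 2 * t * (1 - t) * p i j k0 + t\<^sup>2"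
    using ple[of i i k0] by (simp add: mult_left_le)
  \<comment> \<open>With \<open>p i j k0 = 1 / 2 - 2 * t\<close> the right-hand side becomes 1 - t -
    3 t^2 + 4 t^3, so the terms of order 0 and 1 cancel.\<close>
  finally have "t * t * (3 - 4 * t) \<le> 0"
    unfolding pt by (simp add: power2_eq_square algebra_simps)
  moreover have "0 < t * t * (3 - 4 * t)" using t by simp
  ultimately show False by simp
qed

lemma dissipative_qso_support:
  fixes V :: "real ^ 'n::finite \<Rightarrow> real ^ 'n"
  assumes qso: "qso_with p V" and diss: "dissipative V" and card: "CARD('n) \<ge> 3"
  obtains u v where "\<And>k. k \<noteq> u \<Longrightarrow> k \<noteq> v \<Longrightarrow> p i j k = 0"
proof -
  have p0: "0 \<le> p r s k" for r s k
    using qso unfolding qso_with_def by auto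
  \<comment> \<open>For j = i any other vertex serves as second endpoint: \<open>p i i k\<close>
    also contributes to V on that edge.\<close>
  obtain j' where j': "j' \<noteq> i" "j = i \<or> j = j'"
  proof (cases "j = i")
    case True
    have "(UNIV :: 'n set) \<noteq> {i}"
    proof
      assume "(UNIV :: 'n set) = {i}"
      then have "CARD('n) = card {i}" by simp
      then show False using card by simp
    qed
    then show thesis using that True by blast
  qed (use that in blast)
  define x where "x = edge_point i j' (1 / 2)"
  have x: "x \<in> std_simplex" unfolding x_def by (rule edge_point_in_simplex) auto
  have Vx: "V x \<in> std_simplex" using qso_in_simplex[OF qso x] .
  have "1 = x $ i + x $ j'" using j'(1) by (simp add: x_def edge_point_nth)
  also have "\<dots> \<le> decr x 1 + decr x 2" using add_le_decr_1_2 j'(1) by metis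
  also have "\<dots> \<le> decr (V x) 1 + decr (V x) 2"
    using majorized_by_decr_2[OF _ card] diss x unfolding dissipative_def by blast
  finally have ge: "1 \<le> decr (V x) 1 + decr (V x) 2" .
  obtain u v where uv: "u \<noteq> v" "decr (V x) 1 = V x $ u" "decr (V x) 2 = V x $ v"
    using decr_1_2_attained[of "V x"] card by auto
  show thesis
  proof (rule that)
    fix k assume "k \<noteq> u" "k \<noteq> v"
    then have "V x $ k = 0" using std_simplex_nth_eq_0[OF Vx uv(1)] ge uv by simp
    \<comment> \<open>At the midpoint all three weights are positive (1/4, 1/2, 1/4), so a vanishing
      coordinate of \<open>V x\<close> forces each of these nonnegative coefficients to
      vanish.\<close>
    then have "p i i k + 2 * p j' i k + p j' j' k = 0"
      using qso_edge_point[OF qso, of "1 / 2" i j' k] by (simp add: x_def power2_eq_square)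
    moreover have "p i j' k = p j' i k" using qso unfolding qso_with_def by blast
    ultimately show "p i j k = 0"
      using j'(2) p0[of i i k] p0[of j' i k] p0[of j' j' k] by auto
  qed
qed

theorem lemma3p2:
  fixes V :: "real ^ 'n::{finite,linorder} \<Rightarrow> real ^ 'n::{finite,linorder}"
    and p :: "'n \<Rightarrow> 'n \<Rightarrow> 'n \<Rightarrow> real"
    and \<alpha> :: "'n \<Rightarrow> 'n set"
    and a :: "'n \<Rightarrow> 'n \<Rightarrow> real ^ 'n::{finite,linorder}"
  assumes qso: "qso_with p V"
    and diss: "dissipative V"
    and disj: "\<And>k l. k \<noteq> l \<Longrightarrow> \<alpha> k \<inter> \<alpha> l = {}"
    and cover: "(\<Union>k. \<alpha> k) = UNIV"
    and form: "\<And>x k. x \<in> std_simplex \<Longrightarrow>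
      V x $ k = (\<Sum>i\<in>\<alpha> k. (x $ i)\<^sup>2) + 2 * (\<Sum>(i, j)\<in>{(i, j). i < j}. p i j k * x $ i * x $ j)"
    and a_def: "\<And>i j. a i j = (\<chi> k. p i j k)"
  shows "(\<forall>j k0. j \<in> \<alpha> k0 \<longrightarrow>
            (\<forall>i. p i j k0 = decr (a i j) 1 \<and> decr (a i j) 1 \<ge> 1 / 2)) \<and>
         (CARD('n) \<ge> 3 \<longrightarrow> (\<forall>k\<in>{3..CARD('n)}. \<forall>i j. decr (a i j) k = 0))"
proof (intro conjI allI impI ballI)
  have p0: "0 \<le> p i j k" and p1: "(\<Sum>k\<in>UNIV. p i j k) = 1" for i j k
    using qso unfolding qso_with_def by auto
  {
    fix j k0 i assume j: "j \<in> \<alpha> k0"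
    \<comment> \<open>Both expressions for V are evaluated at the vertex j. There the square sum
      keeps only the term of j, and each mixed product has a zero factor, which gives
      \<open>p j j k0 = 1\<close>.\<close>
    let ?e = "edge_point j j 0"
    have "p j j k0 = V ?e $ k0"
      using qso_edge_point[OF qso, of 0 j j k0] by simp
    also have "\<dots> = (\<Sum>i\<in>\<alpha> k0. (?e $ i)\<^sup>2)
        + 2 * (\<Sum>(i, j)\<in>{(i, j). i < j}. p i j k0 * ?e $ i * ?e $ j)"
      by (intro form edge_point_in_simplex) auto
    also have "(\<Sum>i\<in>\<alpha> k0. (?e $ i)\<^sup>2) = (\<Sum>i\<in>\<alpha> k0. if i = j then 1 else 0)"
      by (intro sum.cong) (auto simp: edge_point_nth)
    also have "\<dots> = 1" using j by simp
    also have "(\<Sum>(i, j)\<in>{(i, j). i < j}. p i j k0 * ?e $ i * ?e $ j) = 0"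
      by (intro sum.neutral) (auto simp: edge_point_nth)
    finally have "p j j k0 = 1" by simp
    then have half: "1 / 2 \<le> p i j k0" by (rule dissipative_qso_half_le[OF qso diss])
    have "a i j \<in> std_simplex" using p0 p1 by (simp add: std_simplex_def a_def)
    \<comment> \<open>Two coordinates of a simplex point sum to at most 1, so next to one that is at
      least 1/2 every other is at most 1/2.\<close>
    then have "a i j $ k \<le> p i j k0" for k
      using std_simplex_add_le_1[of "a i j" k k0] half by (cases "k = k0") (auto simp: a_def)
    then have "decr (a i j) 1 \<le> p i j k0" using decr_1_attained by metis
    moreover have "p i j k0 \<le> decr (a i j) 1"
      using le_decr_1[of "a i j" k0] by (simp add: a_def)
    ultimately show "p i j k0 = decr (a i j) 1" by simp
    with half show "1 / 2 \<le> decr (a i j) 1" by simp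
  }
  fix k i j assume card: "3 \<le> CARD('n)" and k: "k \<in> {3..CARD('n)}"
  obtain u v where "\<And>k. k \<noteq> u \<Longrightarrow> k \<noteq> v \<Longrightarrow> p i j k = 0"
    using dissipative_qso_support[OF qso diss card] by metis
  then show "decr (a i j) k = 0"
    using k p0 by (intro decr_eq_0_if_support_le_2[of _ u v]) (auto simp: a_def)
qed

end
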